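(* Suppose that the standing assumptions (SA1), (SA2), (SA3) and Assumption 2 of the context hold. Then the sets $H^i(x)$, $H_r^i(x)$ and $H_r^{\star,i}(x)$ generated by the algorithm PI$^+$ are non-empty for any $i\in\mathbb{Z}_{\ge0}$ and $x\in\mathbb{R}^{n_x}$.
   Context: Notation. $\mathbb{R}_{\ge0}=[0,\infty)$, $\mathbb{Z}_{\ge0}=\{0,1,\dots\}$; $\mathbb{B}$ is the closed unit ball of $\mathbb{R}^{n_x}$. $\mathcal{K}_\infty$: continuous, strictly increasing, unbounded functions $\mathbb{R}_{\ge0}\to\mathbb{R}_{\ge0}$ that are zero at zero. A selection of a set-valued map $S$ is a single-valued $s$ with $s(x)\in S(x)$ for all $x\in\operatorname{dom}S$; one writes $s\in S$. A set-valued map $S$ is outer semicontinuous if $x_n\to x$, $u_n\in S(x_n)$, $u_n\to u$ imply $u\in S(x)$. For a set $A$, $S(A)=\bigcup_{a\in A}S(a)$. A function $\ell(x,u)$ is level-bounded in $u$, locally uniform in $x$, if for each $x\in\mathbb{R}^{n_x}$ and $\alpha\in\mathbb{R}$ there are a neighborhood $\mathcal{S}$ of $x$ and a bounded set $B\subset\mathbb{R}^{n_u}$ such that $\{u:\ell(z,u)\le\alpha\}\subset B$ for all $z\in\mathcal{S}$. Plant and cost. $x(k+1)=f(x(k),u(k))$ with $x\in\mathbb{R}^{n_x}$, $u\in\mathcal{U}(x)\subseteq\mathbb{R}^{n_u}$, $\mathcal{U}(x)\neq\emptyset$ for every $x$; $\mathcal{W}=\{(x,u):u\in\mathcal{U}(x)\}$.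 The stage cost is $\ell:\mathbb{R}^{n_x}\times\mathbb{R}^{n_u}\to\mathbb{R}_{\ge0}$. For an admissible infinite input sequence $\mathbf{u}$, $J(x,\mathbf{u})=\sum_{k=0}^\infty\ell(x(k),u(k))$ along the resulting solution from $x(0)=x$. For a policy $h\in\mathcal{U}$, $\phi(k,x,h)$ is the closed-loop solution from $x$ and $J(x,h)=\sum_{k=0}^\infty\ell(\phi(k,x,h),h(\phi(k,x,h)))$. $V^\star(x)=\min_{\mathbf{u}}J(x,\mathbf{u})$. Standing assumptions. $\sigma:\mathbb{R}^{n_x}\to\mathbb{R}_{\ge0}$ is continuous, and $h^0\in\mathcal{U}$ is a given initial policy. (SA1) For every $x$ there is an admissible input sequence $\mathbf{u}^\star(x)$ attaining the minimum $V^\star(x)=J(x,\mathbf{u}^\star(x))<+\infty$. (SA2) There exist a continuous $W:\mathbb{R}^{n_x}\to\mathbb{R}_{\ge0}$, $\alpha_W,\chi_W\in\mathcal{K}_\infty$ and $\overline\alpha_W:\mathbb{R}_{\ge0}\to\mathbb{R}_{\ge0}$ continuous, nondecreasing and zero at zero such that for all $(x,u)\in\mathcal{W}$: $W(x)\le\overline\alpha_W(\sigma(x))$ and $W(f(x,u))-W(x)\le-\alpha_W(\sigma(x))+\chi_W(\ell(x,u))$. (SA3) There exists $\overline\alpha_V\in\mathcal{K}_\infty$ with $J(x,h^0)\le\overline\alpha_V(\sigma(x))$ for all $x\in\mathbb{R}^{n_x}$. Algorithm PI$^+$. $V_r^0:=J(\cdot,h^0)$, $H^0:=H_r^0:=H_r^{\star,0}:=\{h^0\}$.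 For $i\in\mathbb{Z}_{\ge0}$ and all $x$: $H^{i+1}(x):=\operatorname{argmin}_{u\in\mathcal{U}(x)}\{\ell(x,u)+V_r^i(f(x,u))\}$; $H_r^{i+1}(x):=\bigcap_{\delta>0}\overline{H^{i+1}(x+\delta\mathbb{B})}$; $V_r^{i+1}(x):=\min_{h\in H_r^{i+1}}J(x,h)$ (minimum over selections $h$ of $H_r^{i+1}$); $H_r^{\star,i+1}(x):=\operatorname{argmin}_{u\in H_r^{i+1}(x)}\{\ell(x,u)+V_r^{i+1}(f(x,u))\}$. Assumption 2. (i) $f$ and $\ell$ are continuous on $\mathbb{R}^{n_x}\times\mathbb{R}^{n_u}$. (ii) $\ell$ is level-bounded in $u$, locally uniform in $x$. (iii) $\mathcal{U}$ is outer semicontinuous on $\mathbb{R}^{n_x}$. (iv) $V_r^0=J(\cdot,h^0)$ is lower semicontinuous on $\mathbb{R}^{n_x}$. (v) For all $\Delta>0$, $\{x:\sigma(x)\le\Delta\}$ is compact. *)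

theory Defs
  imports "HOL-Analysis.Analysis"
begin

text \<open>Functions on $[0,\infty)$ are total functions on \<^typ>\<open>real\<close> of which only the
  restriction to \<^term>\<open>{0::real..}\<close> is constrained and used.\<close>

definition K_inf :: "(real \<Rightarrow> real) \<Rightarrow> bool" where
  "K_inf \<alpha> \<longleftrightarrow> continuous_on {0..} \<alpha> \<and> strict_mono_on {0..} \<alpha> \<and>
     \<not> bdd_above (\<alpha> ` {0..}) \<and> \<alpha> 0 = 0"

definition selection :: "('x \<Rightarrow> 'u set) \<Rightarrow> ('x \<Rightarrow> 'u) \<Rightarrow> bool" where
  "selection S s \<longleftrightarrow> (\<forall>x. S x \<noteq> {} \<longrightarrow> s x \<in> S x)"

definition outer_semicontinuous ::
    "('x::topological_space \<Rightarrow> ('u::topological_space) set) \<Rightarrow> bool" where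
  "outer_semicontinuous S \<longleftrightarrow>
     (\<forall>X x V u. X \<longlonglongrightarrow> x \<longrightarrow> (\<forall>n::nat. V n \<in> S (X n)) \<longrightarrow> V \<longlonglongrightarrow> u \<longrightarrow> u \<in> S x)"

definition lower_semicontinuous ::
    "('x::topological_space \<Rightarrow> 'c::complete_lattice) \<Rightarrow> bool" where
  "lower_semicontinuous g \<longleftrightarrow> (\<forall>x. g x \<le> Liminf (at x) g)"

definition level_bounded_locally_uniform ::
    "('x::topological_space \<Rightarrow> 'u::metric_space \<Rightarrow> real) \<Rightarrow> bool" where
  "level_bounded_locally_uniform ell \<longleftrightarrow>
     (\<forall>x \<alpha>. \<exists>N B. open N \<and> x \<in> N \<and> bounded B \<and> (\<forall>z\<in>N. {u. ell z u \<le> \<alpha>} \<subseteq> B))"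

primrec open_loop :: "('x \<Rightarrow> 'u \<Rightarrow> 'x) \<Rightarrow> 'x \<Rightarrow> (nat \<Rightarrow> 'u) \<Rightarrow> nat \<Rightarrow> 'x" where
  "open_loop f x u 0 = x"
| "open_loop f x u (Suc k) = f (open_loop f x u k) (u k)"

definition admissible ::
    "('x \<Rightarrow> 'u \<Rightarrow> 'x) \<Rightarrow> ('x \<Rightarrow> 'u set) \<Rightarrow> 'x \<Rightarrow> (nat \<Rightarrow> 'u) \<Rightarrow> bool" where
  "admissible f U x u \<longleftrightarrow> (\<forall>k. u k \<in> U (open_loop f x u k))"

text \<open>Costs are infinite sums of non-negative reals and may be infinite, hence live in
  \<^typ>\<open>ennreal\<close>.\<close>

definition seq_cost ::
    "('x \<Rightarrow> 'u \<Rightarrow> 'x) \<Rightarrow> ('x \<Rightarrow> 'u \<Rightarrow> real) \<Rightarrow> 'x \<Rightarrow> (nat \<Rightarrow> 'u) \<Rightarrow> ennreal" where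
  "seq_cost f ell x u = (\<Sum>k. ennreal (ell (open_loop f x u k) (u k)))"

primrec closed_loop :: "('x \<Rightarrow> 'u \<Rightarrow> 'x) \<Rightarrow> 'x \<Rightarrow> ('x \<Rightarrow> 'u) \<Rightarrow> nat \<Rightarrow> 'x" where
  "closed_loop f x h 0 = x"
| "closed_loop f x h (Suc k) = f (closed_loop f x h k) (h (closed_loop f x h k))"

definition policy_cost ::
    "('x \<Rightarrow> 'u \<Rightarrow> 'x) \<Rightarrow> ('x \<Rightarrow> 'u \<Rightarrow> real) \<Rightarrow> 'x \<Rightarrow> ('x \<Rightarrow> 'u) \<Rightarrow> ennreal" where
  "policy_cost f ell x h = (\<Sum>k. ennreal (ell (closed_loop f x h k) (h (closed_loop f x h k))))"

text \<open>Minima are rendered by \<^const>\<open>Least\<close>, not by an infimum: the value is meaningful only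
  if the minimum is attained.\<close>

definition opt_value ::
    "('x \<Rightarrow> 'u \<Rightarrow> 'x) \<Rightarrow> ('x \<Rightarrow> 'u \<Rightarrow> real) \<Rightarrow> ('x \<Rightarrow> 'u set) \<Rightarrow> 'x \<Rightarrow> ennreal" where
  "opt_value f ell U x = (LEAST v. \<exists>u. admissible f U x u \<and> v = seq_cost f ell x u)"

definition argmin_on :: "'u set \<Rightarrow> ('u \<Rightarrow> 'c::linorder) \<Rightarrow> 'u set" where
  "argmin_on A g = {u. is_arg_min g (\<lambda>v. v \<in> A) u}"

definition osc_regularization ::
    "('x::metric_space \<Rightarrow> ('u::topological_space) set) \<Rightarrow> 'x \<Rightarrow> 'u set" where
  "osc_regularization S x = (\<Inter>\<delta>\<in>{0<..}. closure (\<Union>y\<in>cball x \<delta>. S y))"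

context
  fixes f :: "'x::metric_space \<Rightarrow> 'u::topological_space \<Rightarrow> 'x"
    and ell :: "'x \<Rightarrow> 'u \<Rightarrow> real"
    and U :: "'x \<Rightarrow> 'u set"
    and h0 :: "'x \<Rightarrow> 'u"
begin

fun PI_H :: "nat \<Rightarrow> 'x \<Rightarrow> 'u set"
  and PI_Hr :: "nat \<Rightarrow> 'x \<Rightarrow> 'u set"
  and PI_Vr :: "nat \<Rightarrow> 'x \<Rightarrow> ennreal" where
  "PI_H 0 = (\<lambda>x. {h0 x})"
| "PI_H (Suc i) = (\<lambda>x. argmin_on (U x) (\<lambda>u. ennreal (ell x u) + PI_Vr i (f x u)))"
| "PI_Hr 0 = (\<lambda>x. {h0 x})"
| "PI_Hr (Suc i) = osc_regularization (PI_H (Suc i))"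
| "PI_Vr 0 = (\<lambda>x. policy_cost f ell x h0)"
| "PI_Vr (Suc i) =
     (\<lambda>x. LEAST v. \<exists>h. selection (PI_Hr (Suc i)) h \<and> v = policy_cost f ell x h)"

fun PI_Hr_star :: "nat \<Rightarrow> 'x \<Rightarrow> 'u set" where
  "PI_Hr_star 0 = (\<lambda>x. {h0 x})"
| "PI_Hr_star (Suc i) =
     (\<lambda>x. argmin_on (PI_Hr (Suc i) x) (\<lambda>u. ennreal (ell x u) + PI_Vr (Suc i) (f x u)))"

end

end

theory Submission imports Defs begin

text \<open>A value function \<open>V\<close> that is lower semicontinuous and locally bounded is passed along the
  iteration, together with a policy in \<open>U\<close> attaining it. Local boundedness of \<open>V\<close>
  confines the minimizers of \<open>\<ell> + V \<circ> f\<close> to locally uniform compact sets, so they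
  exist and their regularization \<open>S\<close> has compact values, closed graph and values in \<open>U\<close>.
  The optimal cost over selections of \<open>S\<close> is the supremum of the value iterates started at \<open>0\<close>;
  it is lower semicontinuous, by compactness it satisfies the Bellman inequality, and, the stage
  cost being non-negative, a minimizing selection attains it from all initial states
  simultaneously. Policy improvement shows that the new value function is at most the old one.\<close>

section \<open>Lower semicontinuity\<close>

text \<open>The liminf in the definition is over punctured neighbourhoods, but
  \<open>c < g x\<close> holds at \<open>x\<close> itself, so the point can be put back. Closed
  sublevel sets make the later closure properties a matter of set algebra.\<close>

lemma lower_semicontinuous_iff_closed:
  fixes g :: "'a::topological_space \<Rightarrow> 'c::complete_linorder"
  shows "lower_semicontinuous g \<longleftrightarrow> (\<forall>c. closed {x. g x \<le> c})"
proof -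
  have at_nhds: "(\<forall>\<^sub>F y in at x. c < g y) \<longleftrightarrow> (\<forall>\<^sub>F y in nhds x. c < g y)"
    if "c < g x" for c x
    unfolding eventually_nhds_conv_at using that by simp
  have "lower_semicontinuous g \<longleftrightarrow> (\<forall>c. \<forall>x. c < g x \<longrightarrow> (\<forall>\<^sub>F y in nhds x. c < g y))"
    unfolding lower_semicontinuous_def le_Liminf_iff using at_nhds by auto
  also have "\<dots> \<longleftrightarrow> (\<forall>c. open {x. c < g x})"
    by (subst open_subopen) (simp add: eventually_nhds subset_eq Ball_def)
  also have "\<dots> \<longleftrightarrow> (\<forall>c. closed {x. g x \<le> c})"
    by (simp add: closed_def Collect_neg_eq[symmetric] not_le)
  finally show ?thesis .
qed

lemma lower_semicontinuous_compose:
  fixes g :: "'b::topological_space \<Rightarrow> 'c::complete_linorder"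
  assumes "lower_semicontinuous g" "continuous_on UNIV \<phi>"
  shows "lower_semicontinuous (\<lambda>x. g (\<phi> x))"
proof -
  have "closed (\<phi> -` {y. g y \<le> c})" for c
    using assms by (intro closed_vimage) (auto simp: lower_semicontinuous_iff_closed)
  then show ?thesis
    by (simp add: lower_semicontinuous_iff_closed vimage_def)
qed

lemma lower_semicontinuous_SUP:
  fixes g :: "'i \<Rightarrow> 'a::topological_space \<Rightarrow> 'c::complete_linorder"
  assumes "\<And>i. i \<in> I \<Longrightarrow> lower_semicontinuous (g i)"
  shows "lower_semicontinuous (\<lambda>x. SUP i\<in>I. g i x)"
proof -
  have "{x. (SUP i\<in>I. g i x) \<le> c} = (\<Inter>i\<in>I. {x. g i x \<le> c})" for c
    by (auto simp: SUP_le_iff)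
  then show ?thesis
    using assms by (auto simp: lower_semicontinuous_iff_closed intro!: closed_INT)
qed

text \<open>A sum exceeds \<open>c\<close> exactly when some real threshold \<open>t\<close>
  satisfies \<open>t < a x\<close> and \<open>ennreal t + V x > c\<close>. Each sublevel set of the
  sum is thus an intersection of unions of two closed sets, even where \<open>V\<close> is
  infinite.\<close>

lemma lower_semicontinuous_ennreal_add:
  fixes a :: "'a::topological_space \<Rightarrow> real"
  assumes a: "continuous_on UNIV a" and V: "lower_semicontinuous V"
  shows "lower_semicontinuous (\<lambda>x. ennreal (a x) + V x)"
  unfolding lower_semicontinuous_iff_closed
proof
  fix c :: ennreal
  have eq: "{x. ennreal (a x) + V x \<le> c} = (\<Inter>t. {x. a x \<le> t} \<union> {x. ennreal t + V x \<le> c})"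
  proof (intro equalityI subsetI)
    fix x assume x: "x \<in> {x. ennreal (a x) + V x \<le> c}"
    have "ennreal t + V x \<le> c" if "\<not> a x \<le> t" for t
    proof -
      have "ennreal t + V x \<le> ennreal (a x) + V x"
        using that by (intro add_right_mono ennreal_leI) simp
      also have "\<dots> \<le> c"
        using x by simp
      finally show ?thesis .
    qed
    then show "x \<in> (\<Inter>t. {x. a x \<le> t} \<union> {x. ennreal t + V x \<le> c})"
      by blast
  next
    fix x assume x: "x \<in> (\<Inter>t. {x. a x \<le> t} \<union> {x. ennreal t + V x \<le> c})"
    \<comment> \<open>The threshold \<open>t = a x - e\<close> lies strictly below
      \<open>a x\<close>, so only the second set of the union can contain \<open>x\<close>; the
      slack \<open>e\<close> then tends to zero.\<close>
    have "ennreal (a x) + V x \<le> c + ennreal e" if "0 < e" for e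
    proof -
      \<comment> \<open>\<open>ennreal\<close> sends negative reals to zero; the \<open>max\<close>
        covers the case \<open>a x < e\<close>.\<close>
      have "ennreal (a x) \<le> ennreal (max 0 (a x - e) + e)"
        by (rule ennreal_leI) simp
      also have "\<dots> = ennreal (a x - e) + ennreal e"
        using that by (subst ennreal_plus) (auto simp: max_def ennreal_neg)
      finally have "ennreal (a x) \<le> ennreal (a x - e) + ennreal e" .
      then have "ennreal (a x) + V x \<le> ennreal (a x - e) + ennreal e + V x"
        by (rule add_right_mono)
      also have "\<dots> = (ennreal (a x - e) + V x) + ennreal e"
        by (simp add: ac_simps)
      also have "ennreal (a x - e) + V x \<le> c"
        using INT_D[OF x, of "a x - e"] that by auto
      finally show ?thesis by (simp add: add_right_mono)
    qed
    then show "x \<in> {x. ennreal (a x) + V x \<le> c}"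
      by (auto intro: ennreal_le_epsilon)
  qed
  have "closed {x. ennreal t + V x \<le> c}" for t
  proof (cases "ennreal t \<le> c")
    case True
    have "ennreal t + V x \<le> c \<longleftrightarrow> V x \<le> c - ennreal t" for x
      using True by (auto simp: ennreal_le_minus_iff add.commute)
    then show ?thesis
      using V by (simp add: lower_semicontinuous_iff_closed)
  next
    case False
    then have "{x. ennreal t + V x \<le> c} = {}"
      by (auto dest: order_trans[OF add_increasing2[OF zero_le order_refl]])
    then show ?thesis by simp
  qed
  moreover have "closed {x. a x \<le> t}" for t
    using a by (intro closed_Collect_le) auto
  ultimately show "closed {x. ennreal (a x) + V x \<le> c}"
    unfolding eq by (intro closed_INT ballI closed_Un) auto
qed

text \<open>Minimizers are the common points of the closed sets \<open>{u. g u \<le> g v}\<close>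
  with \<open>v\<close> in \<open>K\<close>. Finitely many of these meet at the best of the finitely
  many \<open>v\<close>, so compactness gives a point in all of them.\<close>

lemma lower_semicontinuous_attains_inf:
  fixes g :: "'a::topological_space \<Rightarrow> 'c::complete_linorder"
  assumes "compact K" "K \<noteq> {}" and g: "lower_semicontinuous g"
  obtains u where "u \<in> K" "\<And>v. v \<in> K \<Longrightarrow> g u \<le> g v"
proof -
  have "K \<inter> (\<Inter>v\<in>K. {u. g u \<le> g v}) \<noteq> {}"
  proof (rule compact_imp_fip_image[OF \<open>compact K\<close>])
    fix I assume I: "finite I" "I \<subseteq> K"
    show "K \<inter> (\<Inter>v\<in>I. {u. g u \<le> g v}) \<noteq> {}"
    proof (cases "I = {}")
      case False
      then have "arg_min_on g I \<in> I" "\<And>v. v \<in> I \<Longrightarrow> g (arg_min_on g I) \<le> g v"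
        using I arg_min_if_finite[of I g] by (auto simp: not_less)
      with I show ?thesis by blast
    qed (use \<open>K \<noteq> {}\<close> in auto)
  qed (use g in \<open>auto simp: lower_semicontinuous_iff_closed\<close>)
  then show thesis using that by blast
qed

section \<open>Set-valued maps\<close>

text \<open>Together with outer semicontinuity this gives compact values and lets inputs chosen
  along a convergent sequence of states cluster at an input of the limit state.\<close>

definition locally_bounded_map ::
    "('x::topological_space \<Rightarrow> 'u::metric_space set) \<Rightarrow> bool" where
  "locally_bounded_map S \<longleftrightarrow> (\<forall>x. \<exists>N. open N \<and> x \<in> N \<and> bounded (\<Union>z\<in>N. S z))"

lemma outer_semicontinuous_closed:
  fixes S :: "'x::topological_space \<Rightarrow> 'u::first_countable_topology set"
  assumes "outer_semicontinuous S"
  shows "closed (S x)"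
  unfolding closed_sequential_limits
  using assms tendsto_const[of x sequentially] unfolding outer_semicontinuous_def by blast

lemma compact_values:
  fixes S :: "'x::topological_space \<Rightarrow> 'u::heine_borel set"
  assumes "outer_semicontinuous S" "locally_bounded_map S"
  shows "compact (S x)"
proof -
  obtain N where "x \<in> N" "bounded (\<Union>z\<in>N. S z)"
    using assms(2) unfolding locally_bounded_map_def by blast
  then have "bounded (S x)"
    by (blast intro: bounded_subset)
  then show ?thesis
    using outer_semicontinuous_closed[OF assms(1)] by (simp add: compact_eq_bounded_closed)
qed

lemma osc_regularization_superset: "S x \<subseteq> osc_regularization S x"
  unfolding osc_regularization_def
  by (intro INT_greatest order_trans[OF _ closure_subset] UN_upper) simp

text \<open>Once \<open>X n\<close> is within \<open>\<delta> / 2\<close> of \<open>x\<close>, its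
  ball of radius \<open>\<delta> / 2\<close> lies in the ball of radius \<open>\<delta>\<close>
  around \<open>x\<close>, whose closed image therefore contains the limit.\<close>

lemma outer_semicontinuous_osc_regularization:
  "outer_semicontinuous (osc_regularization S)"
  unfolding outer_semicontinuous_def
proof (intro allI impI)
  fix X x V u
  assume X: "X \<longlonglongrightarrow> x" and V: "\<forall>n. V n \<in> osc_regularization S (X n)" and u: "V \<longlonglongrightarrow> u"
  have "u \<in> closure (\<Union>y\<in>cball x \<delta>. S y)" if "0 < \<delta>" for \<delta>
  proof (rule Lim_in_closed_set[OF closed_closure _ _ u])
    have "\<forall>\<^sub>F n in sequentially. dist (X n) x < \<delta> / 2"
      using X that half_gt_zero unfolding tendsto_iff by blast
    then show "\<forall>\<^sub>F n in sequentially. V n \<in> closure (\<Union>y\<in>cball x \<delta>. S y)"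
    proof eventually_elim
      case (elim n)
      have "cball (X n) (\<delta> / 2) \<subseteq> cball x \<delta>"
      proof
        fix y assume "y \<in> cball (X n) (\<delta> / 2)"
        then show "y \<in> cball x \<delta>"
          using elim dist_triangle[of x y "X n"] by (simp add: dist_commute)
      qed
      then have "closure (\<Union>y\<in>cball (X n) (\<delta> / 2). S y) \<subseteq> closure (\<Union>y\<in>cball x \<delta>. S y)"
        by (intro closure_mono) blast
      moreover have "V n \<in> closure (\<Union>y\<in>cball (X n) (\<delta> / 2). S y)"
        using V that unfolding osc_regularization_def by auto
      ultimately show ?case by blast
    qed
  qed simp
  then show "u \<in> osc_regularization S x"
    by (auto simp: osc_regularization_def)
qed

text \<open>Every regularized input is a limit of inputs from \<open>S\<close> at states tending to
  \<open>x\<close>, and the closed graph of \<open>U\<close> retains this limit. Hence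
  regularization keeps policies admissible.\<close>

lemma osc_regularization_subset:
  fixes S :: "'x::metric_space \<Rightarrow> 'u::metric_space set"
  assumes U: "outer_semicontinuous U" and S: "\<And>x. S x \<subseteq> U x"
  shows "osc_regularization S x \<subseteq> U x"
proof
  fix u assume u: "u \<in> osc_regularization S x"
  have "\<exists>y v. dist y x \<le> inverse (real (Suc n)) \<and> v \<in> S y \<and> dist v u \<le> inverse (real (Suc n))"
    for n
  proof -
    have "u \<in> closure (\<Union>y\<in>cball x (inverse (real (Suc n))). S y)"
      using u by (auto simp: osc_regularization_def)
    then obtain v where "v \<in> (\<Union>y\<in>cball x (inverse (real (Suc n))). S y)"
        "dist v u < inverse (real (Suc n))"
      using closure_approachable[of u] by (metis inverse_positive_iff_positive of_nat_0_less_iff zero_less_Suc)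
    then show ?thesis by (metis UN_E dist_commute less_imp_le mem_cball)
  qed
  then obtain Y V where YV: "\<And>n. dist (Y n) x \<le> inverse (real (Suc n))" "\<And>n. V n \<in> S (Y n)"
      "\<And>n. dist (V n) u \<le> inverse (real (Suc n))"
    by metis
  have "Y \<longlonglongrightarrow> x"
    by (rule tendsto_dist_iff[THEN iffD2])
      (rule tendsto_sandwich[OF _ _ tendsto_const LIMSEQ_inverse_real_of_nat], use YV in auto)
  moreover have "V \<longlonglongrightarrow> u"
    by (rule tendsto_dist_iff[THEN iffD2])
      (rule tendsto_sandwich[OF _ _ tendsto_const LIMSEQ_inverse_real_of_nat],
        use YV in auto)
  moreover have "\<forall>n. V n \<in> U (Y n)"
    using YV S by blast
  ultimately show "u \<in> U x"
    using U unfolding outer_semicontinuous_def by blast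
qed

lemma locally_bounded_map_osc_regularization:
  fixes S :: "'x::metric_space \<Rightarrow> 'u::metric_space set"
  assumes "locally_bounded_map S"
  shows "locally_bounded_map (osc_regularization S)"
  unfolding locally_bounded_map_def
proof
  fix x
  obtain N where N: "open N" "x \<in> N" "bounded (\<Union>z\<in>N. S z)"
    using assms unfolding locally_bounded_map_def by blast
  then obtain e where e: "0 < e" "ball x e \<subseteq> N"
    by (meson openE)
  have "osc_regularization S z \<subseteq> closure (\<Union>z\<in>N. S z)" if z: "z \<in> ball x (e / 2)" for z
  proof -
    have "cball z (e / 2) \<subseteq> ball x e"
    proof
      fix y assume "y \<in> cball z (e / 2)"
      then show "y \<in> ball x e"
        using z dist_triangle[of x y z] by simp
    qed
    with e have "(\<Union>y\<in>cball z (e / 2). S y) \<subseteq> (\<Union>z\<in>N. S z)"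
      by blast
    then have "closure (\<Union>y\<in>cball z (e / 2). S y) \<subseteq> closure (\<Union>z\<in>N. S z)"
      by (rule closure_mono)
    moreover have "osc_regularization S z \<subseteq> closure (\<Union>y\<in>cball z (e / 2). S y)"
      unfolding osc_regularization_def using e by (intro INT_lower) simp
    ultimately show ?thesis by blast
  qed
  then have "bounded (\<Union>z\<in>ball x (e / 2). osc_regularization S z)"
    by (intro bounded_subset[OF bounded_closure[OF N(3)]]) blast
  with e show "\<exists>N. open N \<and> x \<in> N \<and> bounded (\<Union>z\<in>N. osc_regularization S z)"
    by (intro exI[of _ "ball x (e / 2)"]) simp
qed

text \<open>Since the infimum is attained, a sublevel set of the marginal function is the projection
  of a sublevel set of \<open>g\<close> on the graph of \<open>S\<close>; local boundedness makes
  this projection closed.\<close>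

lemma lower_semicontinuous_INF:
  fixes S :: "'x::metric_space \<Rightarrow> 'u::heine_borel set"
    and g :: "'x \<times> 'u \<Rightarrow> 'c::complete_linorder"
  assumes S: "outer_semicontinuous S" "locally_bounded_map S" "\<And>x. S x \<noteq> {}"
    and g: "lower_semicontinuous g"
  shows "lower_semicontinuous (\<lambda>x. INF u\<in>S x. g (x, u))"
  unfolding lower_semicontinuous_iff_closed
proof
  fix c
  have "(INF u\<in>S x. g (x, u)) \<le> c \<longleftrightarrow> (\<exists>u\<in>S x. g (x, u) \<le> c)" for x
  proof
    have "lower_semicontinuous (\<lambda>u. g (x, u))"
      by (intro lower_semicontinuous_compose[OF g] continuous_intros)
    then obtain u where "u \<in> S x" "\<And>v. v \<in> S x \<Longrightarrow> g (x, u) \<le> g (x, v)"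
      by (blast intro: lower_semicontinuous_attains_inf[OF compact_values[OF S(1,2)] S(3)])
    moreover from this have "g (x, u) \<le> (INF u\<in>S x. g (x, u))"
      by (intro INF_greatest)
    moreover assume "(INF u\<in>S x. g (x, u)) \<le> c"
    ultimately show "\<exists>u\<in>S x. g (x, u) \<le> c"
      by (blast intro: order_trans)
  qed (blast intro: INF_lower2)
  moreover have "closed {x. \<exists>u\<in>S x. g (x, u) \<le> c}"
    unfolding closed_sequential_limits
  proof (intro allI impI, elim conjE)
    fix X x assume X: "\<forall>n. X n \<in> {x. \<exists>u\<in>S x. g (x, u) \<le> c}" and lim: "X \<longlonglongrightarrow> x"
    then obtain V where V: "\<And>n. V n \<in> S (X n)" "\<And>n. g (X n, V n) \<le> c"
      by simp metis
    obtain N where N: "open N" "x \<in> N" "bounded (\<Union>z\<in>N. S z)"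
      using S(2) unfolding locally_bounded_map_def by blast
    \<comment> \<open>From index \<open>m\<close> on the states stay in \<open>N\<close>, so the
      shifted inputs form a bounded sequence.\<close>
    obtain m where m: "\<And>n. n \<ge> m \<Longrightarrow> X n \<in> N"
      using topological_tendstoD[OF lim N(1,2)] by (auto simp: eventually_sequentially)
    have "bounded (range (\<lambda>n. V (n + m)))"
      by (rule bounded_subset[OF N(3)]) (use V m in force)
    then obtain u r where r: "strict_mono (r :: nat \<Rightarrow> nat)" "((\<lambda>n. V (n + m)) \<circ> r) \<longlonglongrightarrow> u"
      using bounded_imp_convergent_subsequence by blast
    have Xr: "(\<lambda>n. X (r n + m)) \<longlonglongrightarrow> x"
      using LIMSEQ_subseq_LIMSEQ[OF LIMSEQ_ignore_initial_segment[OF lim, of m] r(1)]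
      by (simp add: o_def)
    have Vr: "(\<lambda>n. V (r n + m)) \<longlonglongrightarrow> u"
      using r(2) by (simp add: o_def)
    have "u \<in> S x"
      using S(1) Xr Vr V(1) unfolding outer_semicontinuous_def
      by (elim allE[of _ "\<lambda>n. X (r n + m)"] allE[of _ x] allE[of _ "\<lambda>n. V (r n + m)"]
          allE[of _ u]) simp
    moreover have "(x, u) \<in> {p. g p \<le> c}"
      using g V(2)
      by (intro closed_sequentially[OF _ _ tendsto_Pair[OF Xr Vr]])
        (auto simp: lower_semicontinuous_iff_closed)
    ultimately show "x \<in> {x. \<exists>u\<in>S x. g (x, u) \<le> c}"
      by blast
  qed
  ultimately show "closed {x. (INF u\<in>S x. g (x, u)) \<le> c}"
    by simp
qed

section \<open>Costs of policies\<close>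

lemma closed_loop_Suc_shift:
  "closed_loop f x h (Suc k) = closed_loop f (f x (h x)) h k"
  by (induction k) auto

lemma policy_cost_unfold:
  "policy_cost f ell x h = ennreal (ell x (h x)) + policy_cost f ell (f x (h x)) h"
proof -
  let ?c = "\<lambda>k. ennreal (ell (closed_loop f x h k) (h (closed_loop f x h k)))"
  have "policy_cost f ell x h = (\<Sum>k. ?c (k + 1)) + (\<Sum>k<1. ?c k)"
    unfolding policy_cost_def by (rule suminf_offset) simp
  then show ?thesis
    by (simp add: policy_cost_def closed_loop_Suc_shift add.commute del: closed_loop.simps(2))
qed

lemma policy_cost_le:
  assumes "\<And>x. ennreal (ell x (h x)) + V (f x (h x)) \<le> V x"
  shows "policy_cost f ell x h \<le> V x"
proof -
  let ?z = "closed_loop f x h"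
  have "(\<Sum>k<n. ennreal (ell (?z k) (h (?z k)))) + V (?z n) \<le> V x" for n
  proof (induction n)
    case (Suc n)
    have "(\<Sum>k<Suc n. ennreal (ell (?z k) (h (?z k)))) + V (?z (Suc n))
        = (\<Sum>k<n. ennreal (ell (?z k) (h (?z k)))) +
          (ennreal (ell (?z n) (h (?z n))) + V (f (?z n) (h (?z n))))"
      by (simp add: ac_simps)
    also have "\<dots> \<le> (\<Sum>k<n. ennreal (ell (?z k) (h (?z k)))) + V (?z n)"
      by (intro add_left_mono assms)
    also have "\<dots> \<le> V x"
      by (rule Suc)
    finally show ?case .
  qed simp
  then have "(\<Sum>k<n. ennreal (ell (?z k) (h (?z k)))) \<le> V x" for n
    by (meson add_increasing2 order_refl order_trans zero_le)
  then show ?thesis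
    unfolding policy_cost_def by (intro suminf_le_const) auto
qed

text \<open>Value iteration from zero: the optimal cost over \<open>k\<close> stages with inputs
  restricted to \<open>S\<close> and no terminal cost.\<close>

primrec value_iterate ::
    "('x \<Rightarrow> 'u \<Rightarrow> 'x) \<Rightarrow> ('x \<Rightarrow> 'u \<Rightarrow> real) \<Rightarrow> ('x \<Rightarrow> 'u set) \<Rightarrow> nat \<Rightarrow> 'x \<Rightarrow> ennreal" where
  "value_iterate f ell S 0 x = 0"
| "value_iterate f ell S (Suc k) x =
     (INF u\<in>S x. ennreal (ell x u) + value_iterate f ell S k (f x u))"

lemma incseq_value_iterate: "incseq (\<lambda>k. value_iterate f ell S k x)"
proof (rule incseq_SucI)
  fix k show "value_iterate f ell S k x \<le> value_iterate f ell S (Suc k) x"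
    by (induction k arbitrary: x) (auto intro!: INF_mono' add_left_mono simp: zero_le)
qed

lemma value_iterate_le_policy_cost:
  assumes "\<And>x. h x \<in> S x"
  shows "value_iterate f ell S k x \<le> policy_cost f ell x h"
proof (induction k arbitrary: x)
  case (Suc k)
  show ?case
    unfolding value_iterate.simps policy_cost_unfold[of f ell x]
    by (intro INF_lower2[OF assms] add_left_mono Suc)
qed simp

section \<open>Existence of a selection optimal from every initial state\<close>

context
  fixes f :: "'x::metric_space \<Rightarrow> 'u::heine_borel \<Rightarrow> 'x" and ell :: "'x \<Rightarrow> 'u \<Rightarrow> real"
  assumes f_cont: "continuous_on UNIV (\<lambda>(x, u). f x u)"
    and ell_cont: "continuous_on UNIV (\<lambda>(x, u). ell x u)"
begin

lemma lower_semicontinuous_stage: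
  assumes "lower_semicontinuous V"
  shows "lower_semicontinuous (\<lambda>(x, u). ennreal (ell x u) + V (f x u))"
  using lower_semicontinuous_ennreal_add[OF ell_cont lower_semicontinuous_compose[OF assms f_cont]]
  by (simp add: case_prod_unfold)

lemma lower_semicontinuous_stage_slice:
  assumes "lower_semicontinuous V"
  shows "lower_semicontinuous (\<lambda>u. ennreal (ell x u) + V (f x u))"
  using lower_semicontinuous_compose[OF lower_semicontinuous_stage[OF assms], of "\<lambda>u. (x, u)"]
  by (simp add: continuous_intros)

lemma argmin_stage_nonempty:
  assumes "compact K" "K \<noteq> {}" "lower_semicontinuous V"
  shows "argmin_on K (\<lambda>u. ennreal (ell x u) + V (f x u)) \<noteq> {}"
  using lower_semicontinuous_attains_inf[OF assms(1,2) lower_semicontinuous_stage_slice[OF assms(3), of x]]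
  unfolding argmin_on_def is_arg_min_linorder by blast

text \<open>The limit \<open>V\<close> of value iteration is a lower bound for the cost of every
  selection. A selection along which \<open>V\<close> satisfies the Bellman inequality costs at most
  \<open>V\<close>, hence exactly \<open>V\<close>, from every state at once.\<close>

lemma optimal_selection:
  fixes S :: "'x \<Rightarrow> 'u set"
  assumes S: "outer_semicontinuous S" "locally_bounded_map S" "\<And>x. S x \<noteq> {}"
  obtains h where "selection S h" "lower_semicontinuous (\<lambda>x. policy_cost f ell x h)"
    "\<And>h' x. selection S h' \<Longrightarrow> policy_cost f ell x h \<le> policy_cost f ell x h'"
proof -
  define vi where "vi = value_iterate f ell S"
  define V where "V x = (SUP k. vi k x)" for x
  have lsc: "lower_semicontinuous (vi k)" for k
  proof (induction k)
    case 0
    then show ?case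
      by (simp add: vi_def lower_semicontinuous_iff_closed)
  next
    case (Suc k)
    from lower_semicontinuous_INF[OF S lower_semicontinuous_stage[OF Suc]] show ?case
      by (simp add: vi_def)
  qed
  have "\<exists>u\<in>S x. ennreal (ell x u) + V (f x u) \<le> V x" for x
  proof -
    \<comment> \<open>The minimizers for the iterates \<open>vi k\<close> may vary with
      \<open>k\<close>; the finite intersection property produces one input that serves all
      \<open>k\<close>.\<close>
    have "S x \<inter> (\<Inter>k. {u. ennreal (ell x u) + vi k (f x u) \<le> V x}) \<noteq> {}"
    proof (rule compact_imp_fip_image[OF compact_values[OF S(1,2)]])
      fix I :: "nat set" assume I: "finite I"
      \<comment> \<open>The iterates increase in \<open>k\<close>, so a minimizer for the largest
        index serves all of \<open>I\<close>; inserting \<open>0\<close> covers empty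
        \<open>I\<close>.\<close>
      define m where "m = Max (insert 0 I)"
      obtain u where u: "u \<in> S x"
        "\<And>v. v \<in> S x \<Longrightarrow> ennreal (ell x u) + vi m (f x u) \<le> ennreal (ell x v) + vi m (f x v)"
        by (rule lower_semicontinuous_attains_inf[OF compact_values[OF S(1,2)] S(3)
              lower_semicontinuous_stage_slice[OF lsc]]) blast
      have "ennreal (ell x u) + vi m (f x u) \<le> vi (Suc m) x"
        using u by (auto simp: vi_def intro!: INF_greatest)
      also have "\<dots> \<le> V x"
        unfolding V_def by (rule SUP_upper) simp
      finally have "ennreal (ell x u) + vi m (f x u) \<le> V x" .
      moreover have "vi k (f x u) \<le> vi m (f x u)" if "k \<in> I" for k
        using that I unfolding vi_def m_def by (intro incseqD[OF incseq_value_iterate]) simp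
      ultimately have "ennreal (ell x u) + vi k (f x u) \<le> V x" if "k \<in> I" for k
        using that by (meson add_left_mono order_trans)
      with u show "S x \<inter> (\<Inter>k\<in>I. {u. ennreal (ell x u) + vi k (f x u) \<le> V x}) \<noteq> {}"
        by blast
    next
      show "closed {u. ennreal (ell x u) + vi k (f x u) \<le> V x}" for k
        using lower_semicontinuous_stage_slice[OF lsc]
        by (simp add: lower_semicontinuous_iff_closed)
    qed
    then obtain u where u: "u \<in> S x" "\<And>k. ennreal (ell x u) + vi k (f x u) \<le> V x"
      by blast
    have "ennreal (ell x u) + V (f x u) = (SUP k. ennreal (ell x u) + vi k (f x u))"
      unfolding V_def by (rule ennreal_SUP_add_right) simp
    also have "\<dots> \<le> V x"
      by (intro SUP_least u)
    finally show ?thesis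
      using u by blast
  qed
  then obtain h where h: "\<And>x. h x \<in> S x" "\<And>x. ennreal (ell x (h x)) + V (f x (h x)) \<le> V x"
    by metis
  have low: "V x \<le> policy_cost f ell x h'" if "selection S h'" for h' x
    unfolding V_def vi_def using that S(3)
    by (intro SUP_least value_iterate_le_policy_cost) (simp add: selection_def)
  have sel: "selection S h"
    by (simp add: selection_def h)
  have "policy_cost f ell x h = V x" for x
    by (intro antisym policy_cost_le low sel h(2))
  moreover have "lower_semicontinuous V"
    unfolding V_def by (intro lower_semicontinuous_SUP lsc)
  ultimately show thesis
    using that[OF sel] low by (simp add: fun_eq_iff)
qed

section \<open>The iteration\<close>

context
  fixes U :: "'x \<Rightarrow> 'u set" and h0 :: "'x \<Rightarrow> 'u"
  assumes U_nonempty: "\<And>x. U x \<noteq> {}"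
    and h0: "selection U h0"
    and U_osc: "outer_semicontinuous U"
    and level_bounded: "level_bounded_locally_uniform ell"
    and V0_lsc: "lower_semicontinuous (\<lambda>x. policy_cost f ell x h0)"
    and V0_bounded: "\<And>x. \<exists>N M. open N \<and> x \<in> N \<and> (\<forall>z\<in>N. policy_cost f ell z h0 \<le> ennreal M)"
begin

text \<open>The induction invariant. Lower semicontinuity yields minimizers, the bound by the
  initial cost transfers local boundedness, and realization by one admissible policy yields a
  Bellman equation.\<close>

definition good_value :: "('x \<Rightarrow> ennreal) \<Rightarrow> bool" where
  "good_value V \<longleftrightarrow> lower_semicontinuous V \<and> (\<forall>x. V x \<le> policy_cost f ell x h0) \<and>
     (\<exists>h. selection U h \<and> V = (\<lambda>x. policy_cost f ell x h))"

lemma good_valueE: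
  assumes "good_value V"
  obtains h where "\<And>x. h x \<in> U x" "\<And>x. V x = ennreal (ell x (h x)) + V (f x (h x))"
  using assms U_nonempty policy_cost_unfold unfolding good_value_def selection_def by metis

text \<open>The input \<open>h x\<close> of the policy realizing \<open>V\<close> achieves the value
  \<open>V x\<close>. Any input doing at least as well has stage cost at most
  \<open>\<alpha>\<close>, so the search reduces to a compact part of \<open>U x\<close>.\<close>

lemma argmin_within_level_set:
  assumes V: "good_value V" and \<alpha>: "0 \<le> \<alpha>" "V x \<le> ennreal \<alpha>"
  shows "argmin_on (U x) (\<lambda>u. ennreal (ell x u) + V (f x u)) \<noteq> {}"
    and "argmin_on (U x) (\<lambda>u. ennreal (ell x u) + V (f x u)) \<subseteq> {u. ell x u \<le> \<alpha>}"
proof -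
  let ?g = "\<lambda>u. ennreal (ell x u) + V (f x u)"
  obtain h where h: "\<And>x. h x \<in> U x" "\<And>x. V x = ennreal (ell x (h x)) + V (f x (h x))"
    using good_valueE[OF V] by blast
  have level: "ell x u \<le> \<alpha>" if "?g u \<le> ?g (h x)" for u
  proof -
    have "ennreal (ell x u) \<le> ?g u" by simp
    also have "\<dots> \<le> ennreal \<alpha>" using that h(2)[of x] \<alpha>(2) by simp
    finally show ?thesis using \<alpha>(1) by (simp add: ennreal_le_iff)
  qed
  let ?K = "U x \<inter> {u. ell x u \<le> \<alpha>}"
  have "continuous_on UNIV (ell x)"
    using continuous_on_compose2[OF ell_cont, of UNIV "\<lambda>u. (x, u)"] by (simp add: continuous_intros)
  then have "closed {u. ell x u \<le> \<alpha>}"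
    by (intro closed_Collect_le) auto
  moreover have "bounded {u. ell x u \<le> \<alpha>}"
    using level_bounded unfolding level_bounded_locally_uniform_def
    by (meson bounded_subset)
  ultimately have "compact ?K"
    using outer_semicontinuous_closed[OF U_osc, of x]
    by (auto simp: compact_eq_bounded_closed intro: bounded_Int)
  moreover have "h x \<in> ?K"
    using h(1) level by simp
  moreover have "lower_semicontinuous ?g"
    using V lower_semicontinuous_stage_slice unfolding good_value_def by blast
  ultimately obtain u where u: "u \<in> ?K" "\<And>v. v \<in> ?K \<Longrightarrow> ?g u \<le> ?g v"
    using lower_semicontinuous_attains_inf[of ?K ?g] by blast
  \<comment> \<open>Minimality extends from \<open>?K\<close> to \<open>U x\<close>: an input at
    least as good as \<open>h x\<close> lies in \<open>?K\<close>, and any other is worse than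
    \<open>h x\<close>, which lies in \<open>?K\<close>.\<close>
  have "?g u \<le> ?g v" if "v \<in> U x" for v
  proof (cases "?g v \<le> ?g (h x)")
    case True
    then show ?thesis using u(2) level that by blast
  next
    case False
    then show ?thesis
      using u(2)[OF \<open>h x \<in> ?K\<close>] by (meson le_cases order_trans)
  qed
  with u show "argmin_on (U x) ?g \<noteq> {}"
    unfolding argmin_on_def is_arg_min_linorder by blast
  show "argmin_on (U x) ?g \<subseteq> {u. ell x u \<le> \<alpha>}"
    using h(1) level unfolding argmin_on_def is_arg_min_linorder by blast
qed

lemma good_value_locally_bounded:
  assumes "good_value V"
  obtains N M where "open N" "x \<in> N" "0 \<le> M" "\<And>z. z \<in> N \<Longrightarrow> V z \<le> ennreal M"
proof -
  obtain N M where N: "open N" "x \<in> N" "\<And>z. z \<in> N \<Longrightarrow> policy_cost f ell z h0 \<le> ennreal M"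
    using V0_bounded[of x] by blast
  have "V z \<le> ennreal (max 0 M)" if "z \<in> N" for z
  proof -
    have "V z \<le> policy_cost f ell z h0"
      using assms by (simp add: good_value_def)
    also note N(3)[OF that]
    also have "ennreal M \<le> ennreal (max 0 M)"
      by (intro ennreal_leI) simp
    finally show ?thesis .
  qed
  with N that[of N "max 0 M"] show thesis by simp
qed

text \<open>One bound \<open>M\<close> for \<open>V\<close> near \<open>x\<close> puts all nearby
  minimizers in level sets of the same height, which level-boundedness encloses in one bounded
  set.\<close>

lemma argmin_map_properties:
  assumes V: "good_value V"
  defines "H \<equiv> \<lambda>x. argmin_on (U x) (\<lambda>u. ennreal (ell x u) + V (f x u))"
  shows "H x \<noteq> {}" "locally_bounded_map H"
proof -
  show "H x \<noteq> {}"
    using good_value_locally_bounded[OF V, of x] argmin_within_level_set(1)[OF V]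
    unfolding H_def by metis
  show "locally_bounded_map H"
    unfolding locally_bounded_map_def
  proof
    fix x
    obtain N M where N: "open N" "x \<in> N" "0 \<le> M" "\<And>z. z \<in> N \<Longrightarrow> V z \<le> ennreal M"
      using good_value_locally_bounded[OF V] by blast
    obtain N' B where N': "open N'" "x \<in> N'" "bounded B" "\<And>z. z \<in> N' \<Longrightarrow> {u. ell z u \<le> M} \<subseteq> B"
      using level_bounded unfolding level_bounded_locally_uniform_def by meson
    have "(\<Union>z\<in>N \<inter> N'. H z) \<subseteq> B"
      using argmin_within_level_set(2)[OF V N(3)] N(4) N'(4) unfolding H_def by blast
    then have "bounded (\<Union>z\<in>N \<inter> N'. H z)"
      using N'(3) bounded_subset by blast
    with N N' show "\<exists>N. open N \<and> x \<in> N \<and> bounded (\<Union>z\<in>N. H z)"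
      by (intro exI[of _ "N \<inter> N'"]) auto
  qed
qed

lemma PI_Hr_properties:
  assumes V: "good_value (PI_Vr f ell U h0 i)"
  shows "outer_semicontinuous (PI_Hr f ell U h0 (Suc i))"
    and "locally_bounded_map (PI_Hr f ell U h0 (Suc i))"
    and "PI_Hr f ell U h0 (Suc i) x \<noteq> {}"
    and "PI_Hr f ell U h0 (Suc i) x \<subseteq> U x"
    and "PI_H f ell U h0 (Suc i) x \<subseteq> PI_Hr f ell U h0 (Suc i) x"
    and "PI_H f ell U h0 (Suc i) x \<noteq> {}"
proof -
  note H = argmin_map_properties[OF V]
  show "outer_semicontinuous (PI_Hr f ell U h0 (Suc i))"
    by (simp add: outer_semicontinuous_osc_regularization)
  show "locally_bounded_map (PI_Hr f ell U h0 (Suc i))"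
    using H(2) by (simp add: locally_bounded_map_osc_regularization)
  show sub: "PI_H f ell U h0 (Suc i) x \<subseteq> PI_Hr f ell U h0 (Suc i) x"
    unfolding PI_Hr.simps by (rule osc_regularization_superset)
  show ne: "PI_H f ell U h0 (Suc i) x \<noteq> {}"
    using H(1) by simp
  show "PI_Hr f ell U h0 (Suc i) x \<noteq> {}"
    using sub ne by blast
  show "PI_Hr f ell U h0 (Suc i) x \<subseteq> U x"
    unfolding PI_Hr.simps
    by (rule osc_regularization_subset[OF U_osc])
      (auto simp: argmin_on_def is_arg_min_linorder)
qed

text \<open>The step combines an optimal selection of the regularized map, which realizes the new
  value, with policy improvement, which keeps this value below the old one.\<close>

lemma good_value_PI_Vr: "good_value (PI_Vr f ell U h0 i)"
proof (induction i)
  case 0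
  show ?case
    using V0_lsc h0 by (auto simp: good_value_def)
next
  case (Suc i)
  let ?V = "PI_Vr f ell U h0 i" and ?S = "PI_Hr f ell U h0 (Suc i)"
  let ?H = "PI_H f ell U h0 (Suc i)"
  note props = PI_Hr_properties[OF Suc]
  obtain h where h: "selection ?S h" "lower_semicontinuous (\<lambda>x. policy_cost f ell x h)"
    "\<And>h' x. selection ?S h' \<Longrightarrow> policy_cost f ell x h \<le> policy_cost f ell x h'"
    using optimal_selection[OF props(1-3)] by blast
  \<comment> \<open>The minimum is taken separately at each state; the single policy
    \<open>h\<close> attains all of these minima.\<close>
  have eq: "PI_Vr f ell U h0 (Suc i) = (\<lambda>x. policy_cost f ell x h)"
    unfolding PI_Vr.simps by (intro ext Least_equality) (use h in blast)+
  have "selection U h"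
    using h(1) props(3,4) unfolding selection_def by blast
  moreover have "policy_cost f ell x h \<le> policy_cost f ell x h0" for x
  proof -
    obtain h' where h': "\<And>x. h' x \<in> ?H x"
      using props(6) by (meson ex_in_conv)
    obtain g where g: "\<And>x. g x \<in> U x" "\<And>x. ?V x = ennreal (ell x (g x)) + ?V (f x (g x))"
      using good_valueE[OF Suc] by blast
    \<comment> \<open>The greedy input \<open>h' x\<close> is compared with \<open>g x\<close>, the
      input of the policy realizing the old value.\<close>
    have "ennreal (ell x (h' x)) + ?V (f x (h' x)) \<le> ?V x" for x
      using h'[of x] g(1)[of x] unfolding g(2)[of x] by (simp add: argmin_on_def is_arg_min_linorder)
    then have "policy_cost f ell x h' \<le> ?V x"
      by (rule policy_cost_le)
    moreover have "policy_cost f ell x h \<le> policy_cost f ell x h'"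
      using h' props(5) by (intro h(3)) (auto simp only: selection_def)
    moreover have "?V x \<le> policy_cost f ell x h0"
      using Suc by (simp add: good_value_def)
    ultimately show ?thesis by simp
  qed
  ultimately show ?case
    using h(2) unfolding good_value_def eq by blast
qed

lemma PI_sets_nonempty:
  "PI_H f ell U h0 i x \<noteq> {} \<and> PI_Hr f ell U h0 i x \<noteq> {} \<and> PI_Hr_star f ell U h0 i x \<noteq> {}"
proof (cases i)
  case (Suc j)
  note props = PI_Hr_properties[OF good_value_PI_Vr[of j]]
  have "lower_semicontinuous (PI_Vr f ell U h0 (Suc j))"
    using good_value_PI_Vr unfolding good_value_def by blast
  then have "PI_Hr_star f ell U h0 (Suc j) x \<noteq> {}"
    unfolding PI_Hr_star.simps by (intro argmin_stage_nonempty compact_values props)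
  with props Suc show ?thesis by blast
qed simp

end

end

theorem theorem3:
  fixes f :: "real ^ 'n \<Rightarrow> real ^ 'm \<Rightarrow> real ^ 'n"
    and ell :: "real ^ 'n \<Rightarrow> real ^ 'm \<Rightarrow> real"
    and U :: "real ^ 'n \<Rightarrow> (real ^ 'm) set"
    and \<sigma> :: "real ^ 'n \<Rightarrow> real"
    and h0 :: "real ^ 'n \<Rightarrow> real ^ 'm"
    and i :: nat and x :: "real ^ 'n"
  assumes U_nonempty: "\<And>x. U x \<noteq> {}"
    and cost_nonneg: "\<And>x u. 0 \<le> ell x u"
    and sigma_nonneg: "\<And>x. 0 \<le> \<sigma> x"
    and sigma_cont: "continuous_on UNIV \<sigma>"
    and h0: "selection U h0"
    and SA1: "\<And>x. \<exists>u. is_arg_min (seq_cost f ell x) (admissible f U x) u \<and>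
                opt_value f ell U x = seq_cost f ell x u \<and> opt_value f ell U x < \<infinity>"
    and SA2: "\<exists>W \<alpha>W \<gamma>W \<alpha>W_bar.
                continuous_on UNIV W \<and> (\<forall>x. 0 \<le> W x) \<and> K_inf \<alpha>W \<and> K_inf \<gamma>W \<and>
                continuous_on {0..} \<alpha>W_bar \<and> mono_on {0..} \<alpha>W_bar \<and> \<alpha>W_bar 0 = 0 \<and>
                (\<forall>x. \<forall>u\<in>U x. W x \<le> \<alpha>W_bar (\<sigma> x) \<and>
                   W (f x u) - W x \<le> - \<alpha>W (\<sigma> x) + \<gamma>W (ell x u))"
    and SA3: "\<exists>\<alpha>V. K_inf \<alpha>V \<and> (\<forall>x. policy_cost f ell x h0 \<le> ennreal (\<alpha>V (\<sigma> x)))"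
    and f_cont: "continuous_on UNIV (\<lambda>(x, u). f x u)"
    and cost_cont: "continuous_on UNIV (\<lambda>(x, u). ell x u)"
    and cost_level_bounded: "level_bounded_locally_uniform ell"
    and U_osc: "outer_semicontinuous U"
    and V0_lsc: "lower_semicontinuous (\<lambda>x. policy_cost f ell x h0)"
    and sigma_compact: "\<And>\<Delta>. 0 < \<Delta> \<Longrightarrow> compact {x. \<sigma> x \<le> \<Delta>}"
  shows "PI_H f ell U h0 i x \<noteq> {} \<and> PI_Hr f ell U h0 i x \<noteq> {} \<and> PI_Hr_star f ell U h0 i x \<noteq> {}"
proof (rule PI_sets_nonempty[OF f_cont cost_cont U_nonempty h0 U_osc cost_level_bounded
      V0_lsc])
  fix x
  obtain \<alpha>V where \<alpha>V: "K_inf \<alpha>V" "\<And>x. policy_cost f ell x h0 \<le> ennreal (\<alpha>V (\<sigma> x))"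
    using SA3 by blast
  \<comment> \<open>On this neighbourhood of \<open>x\<close>, monotonicity of
    \<open>\<alpha>V\<close> turns the bound from \<open>SA3\<close> into the constant
    \<open>\<alpha>V (\<sigma> x + 1)\<close>.\<close>
  have "open {z. \<sigma> z < \<sigma> x + 1}"
    using sigma_cont by (intro open_Collect_less) auto
  moreover have "policy_cost f ell z h0 \<le> ennreal (\<alpha>V (\<sigma> x + 1))" if "\<sigma> z < \<sigma> x + 1" for z
  proof -
    have "\<alpha>V (\<sigma> z) < \<alpha>V (\<sigma> x + 1)"
      using \<alpha>V(1) that sigma_nonneg[of z] sigma_nonneg[of x]
      unfolding K_inf_def by (auto elim: strict_mono_onD)
    with \<alpha>V(2)[of z] show ?thesis
      by (meson ennreal_leI less_imp_le order_trans)
  qed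
  ultimately show "\<exists>N M. open N \<and> x \<in> N \<and> (\<forall>z\<in>N. policy_cost f ell z h0 \<le> ennreal M)"
    by (intro exI[of _ "{z. \<sigma> z < \<sigma> x + 1}"] exI[of _ "\<alpha>V (\<sigma> x + 1)"]) auto
qed

end
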